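(* Let $n>1$ be an odd positive integer. Then \[ \sum_{k=0}^{\frac{n+1}2}[4k-1]\frac{(q^{-2};q^4)_k^2}{(q^4;q^4)_k^2}q^{4k} \equiv -q^n(1-q+q^2) [n]_{q^2}^2\pmod{[n]_{q^2}^2\Phi_n(q^2)}, \] and \[ \sum_{k=0}^{n-1}[4k-1]\frac{(q^{-2};q^4)_k^2}{(q^4;q^4)_k^2}q^{4k} \equiv -(1-q+q^2) [n]_{q^2}^2\pmod{[n]_{q^2}^2\Phi_n(q^2)}. \]
   Context: Here $q$ is an indeterminate. The $q$-shifted factorial is $(x;q)_k=(1-x)(1-xq)\cdots(1-xq^{k-1})$ (with $(x;q)_0=1$). For an integer $m$, $[m]=[m]_q=\frac{1-q^m}{1-q}$ and $[m]_{q^2}=\frac{1-q^{2m}}{1-q^2}$. $\Phi_n(x)$ is the $n$-th cyclotomic polynomial. For rational functions $A,B$ in $q$ and a polynomial $P(q)$, $A\equiv B\pmod P$ means that $A-B$ can be written as a quotient of polynomials whose numerator is divisible by $P$ and whose denominator is coprime to $P$. *)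

theory Defs
  imports
    Complex_Main
    "HOL-Computational_Algebra.Computational_Algebra"
    "HOL-Number_Theory.Totient"
begin

section \<open>Rational functions in the indeterminate \<open>q\<close>\<close>

definition q :: "rat poly fract" where
  "q = to_fract [:0, 1:]"

definition q_pochhammer :: "'a::comm_ring_1 \<Rightarrow> 'a \<Rightarrow> nat \<Rightarrow> 'a" where
  "q_pochhammer x y k = (\<Prod>i<k. 1 - x * y ^ i)"

definition q_int :: "'a::field \<Rightarrow> int \<Rightarrow> 'a" where
  "q_int x m = (1 - x powi m) / (1 - x)"

text \<open>
  A modulus has to be a polynomial. For \<open>m \<ge> 0\<close> the rational function \<open>q_int q m\<close> is one, namely
  \<open>q_int_poly m\<close>; see \<open>to_fract_q_int_poly\<close> below. The substitution \<open>q \<mapsto> q\<^sup>2\<close> in a polynomial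
  is written \<open>p \<circ>\<^sub>p monom 1 2\<close>.
\<close>

definition q_int_poly :: "nat \<Rightarrow> rat poly" where
  "q_int_poly m = (\<Sum>i<m. monom 1 i)"

definition rat_fun_cong :: "rat poly fract \<Rightarrow> rat poly fract \<Rightarrow> rat poly \<Rightarrow> bool" where
  "rat_fun_cong A B P \<longleftrightarrow>
     (\<exists>N D. D \<noteq> 0 \<and> A - B = Fract N D \<and> P dvd N \<and> coprime D P)"

lemma to_fract_power: "to_fract (p ^ i) = to_fract p ^ i"
  by (induction i) simp_all

lemma to_fract_sum: "to_fract (\<Sum>i\<in>A. f i) = (\<Sum>i\<in>A. to_fract (f i))"
  by (induction A rule: infinite_finite_induct) simp_all

lemma to_fract_monom: "to_fract (monom 1 i) = q ^ i"
  by (simp add: q_def monom_altdef flip: to_fract_power)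

lemma q_power_neq_1: "i > 0 \<Longrightarrow> q ^ i \<noteq> 1"
proof
  assume "i > 0" "q ^ i = 1"
  then have "monom (1::rat) i = 1" by (metis to_fract_1 to_fract_eq_iff to_fract_monom)
  then have "degree (monom (1::rat) i) = 0" by simp
  with \<open>i > 0\<close> show False by (simp add: degree_monom_eq)
qed

lemma pcompose_monom_monom: "monom (1::rat) i \<circ>\<^sub>p monom 1 j = monom 1 (j * i)"
  by (induction i) (simp_all add: monom_Suc pcompose_pCons mult_monom pcompose_1)

lemma pcompose_q_int_poly: "q_int_poly m \<circ>\<^sub>p monom 1 j = (\<Sum>i<m. monom 1 (j * i))"
  by (simp add: q_int_poly_def pcompose_sum pcompose_monom_monom)

lemma to_fract_q_int_poly:
  assumes "j > 0"
  shows "to_fract (q_int_poly m \<circ>\<^sub>p monom 1 j) = q_int (q ^ j) (int m)"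
  using q_power_neq_1[OF assms]
  by (simp add: pcompose_q_int_poly to_fract_sum to_fract_monom power_mult q_int_def sum_gp_strict)


section \<open>Cyclotomic polynomials\<close>

text \<open>
  \<open>cyclotomic_complex n\<close> is the product over the primitive \<open>n\<close>-th roots of unity, and
  \<open>cyclotomic n\<close> is its unique preimage in \<open>\<rat>[x]\<close>, which exists by \<open>of_rat_cyclotomic\<close> below.
\<close>

definition cyclotomic_complex :: "nat \<Rightarrow> complex poly" where
  "cyclotomic_complex n = (\<Prod>k\<in>totatives n. [:- cis (2 * pi * real k / real n), 1:])"

definition cyclotomic :: "nat \<Rightarrow> rat poly" where
  "cyclotomic n = (THE p. map_poly of_rat p = cyclotomic_complex n)"

lemma map_poly_of_rat_add:
  "map_poly (of_rat :: rat \<Rightarrow> complex) (p + r) = map_poly of_rat p + map_poly of_rat r"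
  by (intro poly_eqI) (simp add: coeff_map_poly of_rat_add)

lemma map_poly_of_rat_diff:
  "map_poly (of_rat :: rat \<Rightarrow> complex) (p - r) = map_poly of_rat p - map_poly of_rat r"
  by (intro poly_eqI) (simp add: coeff_map_poly of_rat_diff)

lemma map_poly_of_rat_mult:
  "map_poly (of_rat :: rat \<Rightarrow> complex) (p * r) = map_poly of_rat p * map_poly of_rat r"
  by (intro poly_eqI) (simp add: coeff_map_poly coeff_mult of_rat_sum of_rat_mult)

lemma map_poly_of_rat_prod:
  "map_poly (of_rat :: rat \<Rightarrow> complex) (\<Prod>i\<in>A. f i) = (\<Prod>i\<in>A. map_poly of_rat (f i))"
  by (induction A rule: infinite_finite_induct) (simp_all add: map_poly_of_rat_mult)

lemma map_poly_of_rat_eq_iff: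
  "map_poly (of_rat :: rat \<Rightarrow> complex) p = map_poly of_rat r \<longleftrightarrow> p = r"
  by (auto simp: poly_eq_iff coeff_map_poly)

lemma degree_map_poly_of_rat: "degree (map_poly (of_rat :: rat \<Rightarrow> complex) p) = degree p"
  by (intro degree_map_poly) simp

lemma monom_minus_one_eq_prod_roots:
  assumes "n > 0"
  shows "monom 1 n - 1 = (\<Prod>k\<in>{0<..n}. [:- cis (2 * pi * real k / real n), 1:])"
proof (rule poly_eqI_degree_lead_coeff[where A = "{z. z ^ n = 1}"])
  let ?f = "\<lambda>k. cis (2 * pi * real k / real n)"
  let ?P = "\<Prod>k\<in>{0<..n}. [:- ?f k, 1:]"
  have deg: "degree ?P = n"
    by (subst degree_prod_eq_sum_degree) auto
  then show "degree ?P \<le> n" by simp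
  have "coeff ?P n = 1" using lead_coeff_prod[of "\<lambda>k. [:- ?f k, 1:]" "{0<..n}"] deg by simp
  then show "coeff (monom 1 n - 1) n = coeff ?P n" using assms by simp
  show "degree (monom 1 n - 1 :: complex poly) \<le> n"
    by (intro degree_diff_le) (auto simp: degree_monom_eq)
  show "card {z::complex. z ^ n = 1} \<ge> n" using card_roots_unity_eq[OF assms] by simp
  fix z :: complex assume "z \<in> {z. z ^ n = 1}"
  then have z: "z ^ n = 1" by simp
  then have "z \<in> ?f ` {..<n}" using bij_betw_roots_unity[OF assms] by (auto simp: bij_betw_def)
  then obtain k where "k < n" "z = ?f k" by auto
  then have "\<exists>k\<in>{0<..n}. z = ?f k"
    using assms by (cases "k = 0") (auto intro: bexI[of _ n] bexI[of _ k])
  then show "poly (monom 1 n - 1) z = poly ?P z"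
    using z by (auto simp: poly_monom poly_prod)
qed

lemma prod_cyclotomic_complex:
  assumes "n > 0"
  shows "(\<Prod>d | d dvd n. cyclotomic_complex d) = monom 1 n - 1"
proof -
  let ?g = "\<lambda>k. [:- cis (2 * pi * real k / real n), 1:]"
  have *: "cyclotomic_complex (n div d) = (\<Prod>k\<in>{k\<in>{0<..n}. gcd k n = d}. ?g k)"
    if "d dvd n" for d
  proof -
    from that assms have "d > 0" by (auto intro: Nat.gr0I)
    from that obtain m where "n = d * m" by blast
    with \<open>d > 0\<close> have "?g (k * d) = [:- cis (2 * pi * real k / real (n div d)), 1:]" for k
      by (simp add: field_simps)
    then show ?thesis
      unfolding cyclotomic_complex_def
      using prod.reindex_bij_betw[OF bij_betw_totatives_gcd_eq[OF that assms], of ?g] by simp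
  qed
  have "monom 1 n - 1 = (\<Prod>k\<in>{0<..n}. ?g k)"
    by (rule monom_minus_one_eq_prod_roots) fact
  also have "{0<..n} = (\<Union>d\<in>{d. d dvd n}. {k\<in>{0<..n}. gcd k n = d})" by auto
  also have "(\<Prod>k\<in>\<dots>. ?g k) = (\<Prod>d | d dvd n. \<Prod>k\<in>{k\<in>{0<..n}. gcd k n = d}. ?g k)"
    using assms by (intro prod.UNION_disjoint) auto
  also have "\<dots> = (\<Prod>d | d dvd n. cyclotomic_complex (n div d))"
    by (intro prod.cong refl) (use * in auto)
  also have "\<dots> = (\<Prod>d | d dvd n. cyclotomic_complex d)"
    using assms by (intro prod.reindex_bij_witness[of _ "(div) n" "(div) n"]) (auto elim: dvdE)
  finally show ?thesis ..
qed

lemma cyclotomic_complex_neq_0: "cyclotomic_complex n \<noteq> 0"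
  by (simp add: cyclotomic_complex_def)

lemma cyclotomic_complex_rational: "\<exists>p. map_poly of_rat p = cyclotomic_complex n"
proof (induction n rule: less_induct)
  case (less n)
  show ?case
  proof (cases "n = 0")
    case True
    then show ?thesis by (intro exI[of _ 1]) (simp add: cyclotomic_complex_def)
  next
    case False
    let ?h = "map_poly (of_rat :: rat \<Rightarrow> complex)"
    let ?A = "{d. d dvd n \<and> d < n}"
    have "\<forall>d\<in>?A. \<exists>p. ?h p = cyclotomic_complex d" using less.IH by blast
    then obtain f where f: "\<And>d. d \<in> ?A \<Longrightarrow> ?h (f d) = cyclotomic_complex d" by metis
    define B where "B = (\<Prod>d\<in>?A. f d)"
    have hB: "?h B = (\<Prod>d\<in>?A. cyclotomic_complex d)"
      unfolding B_def map_poly_of_rat_prod using f by (intro prod.cong) auto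
    have fin: "finite ?A" by (rule finite_subset[of _ "{..<n}"]) auto
    have "B \<noteq> 0" using hB cyclotomic_complex_neq_0 fin by auto
    have "{d. d dvd n} = insert n ?A" using False dvd_imp_le by fastforce
    then have split: "cyclotomic_complex n * ?h B = monom 1 n - 1"
      using prod_cyclotomic_complex[of n] False fin by (simp add: hB)
    let ?p = "monom (1::rat) n - 1"
    let ?Q = "?p div B" and ?R = "?p mod B"
    have "?h ?p = monom 1 n - 1" by (simp add: map_poly_of_rat_diff map_poly_monom)
    moreover have "?h ?p = ?h ?Q * ?h B + ?h ?R"
      by (simp flip: map_poly_of_rat_mult map_poly_of_rat_add)
    ultimately have eq: "?h ?R = (cyclotomic_complex n - ?h ?Q) * ?h B"
      by (simp add: split[symmetric] algebra_simps)
    have "cyclotomic_complex n - ?h ?Q = 0"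
    proof (rule ccontr)
      assume neq: "cyclotomic_complex n - ?h ?Q \<noteq> 0"
      have "?h B \<noteq> 0" using \<open>B \<noteq> 0\<close> map_poly_of_rat_eq_iff[of B 0] by simp
      with neq eq have "?h ?R \<noteq> 0" and "degree (?h ?R) \<ge> degree (?h B)"
        by (simp_all add: degree_mult_eq)
      then have "?R \<noteq> 0" "degree ?R \<ge> degree B" by (auto simp: degree_map_poly_of_rat)
      with degree_mod_less[OF \<open>B \<noteq> 0\<close>, of ?p] show False by simp
    qed
    then show ?thesis by auto
  qed
qed

lemma of_rat_cyclotomic: "map_poly of_rat (cyclotomic n) = cyclotomic_complex n"
proof -
  have "\<exists>!p. map_poly of_rat p = cyclotomic_complex n"
    using cyclotomic_complex_rational[of n] by (metis map_poly_of_rat_eq_iff)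
  then show ?thesis unfolding cyclotomic_def by (rule theI')
qed

end

theory Submission
  imports
    Defs
    "HOL-Computational_Algebra.Field_as_Ring"
begin

text \<open>
  With base \<open>q\<^sup>4\<close> the sum is very-well-poised and telescopes: the partial sum up to \<open>m\<close> is
  \<open>- (1 + q\<^bsup>4m+1\<^esup>) / (q (1 + q))\<close> times the square of \<open>A = (x; x\<^sup>2)\<^sub>m / (x\<^sup>2; x\<^sup>2)\<^sub>m\<close>, where \<open>x = q\<^sup>2\<close>.
  Now \<open>A\<close> is a central Gaussian binomial divided by the square of \<open>(-x; x)\<^sub>m\<close>, so a factor \<open>[n]\<^sub>x\<close> can be
  split off leaving a denominator coprime to \<open>[n]\<^sub>x\<close>. The remaining quotient only matters modulo
  \<open>\<Phi>\<^sub>n(x)\<close>, hence can be evaluated at a primitive \<open>n\<close>-th root of unity \<open>\<zeta>\<close>, by reflecting the exponents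
  modulo \<open>n\<close>: its square is \<open>\<zeta>\<^bsup>(n+1)/2\<^esup>\<close> for \<open>m = (n + 1) / 2\<close> and \<open>\<zeta>\<^sup>2\<close> for \<open>m = n - 1\<close>.
\<close>

section \<open>Shifted factorials and Gaussian binomials\<close>

lemma q_pochhammer_0 [simp]: "q_pochhammer a y 0 = 1"
  by (simp add: q_pochhammer_def)

lemma q_pochhammer_Suc: "q_pochhammer a y (Suc k) = q_pochhammer a y k * (1 - a * y ^ k)"
  by (simp add: q_pochhammer_def)

lemma q_pochhammer_rec: "q_pochhammer a y (Suc k) = (1 - a) * q_pochhammer (a * y) y k"
  unfolding q_pochhammer_def prod.lessThan_Suc_shift by (simp add: mult_ac)

lemma q_pochhammer_add:
  "q_pochhammer a y (m + k) = q_pochhammer a y m * q_pochhammer (a * y ^ m) y k"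
  by (induction k) (simp_all add: q_pochhammer_Suc power_add mult_ac)

lemma q_pochhammer_mult_minus:
  "q_pochhammer x x k * q_pochhammer (- x) x k = q_pochhammer (x\<^sup>2) (x\<^sup>2) k"
  unfolding q_pochhammer_def prod.distrib[symmetric]
  by (intro prod.cong refl)
     (simp add: algebra_simps power2_eq_square power_mult_distrib)

text \<open>The exponents 1, 3, ..., 2k-1 and 2, 4, ..., 2k interleave to 1, ..., 2k.\<close>

lemma q_pochhammer_odd_even:
  "q_pochhammer x (x\<^sup>2) k * q_pochhammer (x\<^sup>2) (x\<^sup>2) k = q_pochhammer x x (2 * k)"
proof (induction k)
  case (Suc k)
  have "q_pochhammer x x (2 * Suc k) =
      q_pochhammer x x (2 * k) * (1 - x * x ^ (2 * k)) * (1 - x * x ^ Suc (2 * k))"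
    by (simp add: q_pochhammer_Suc)
  also have "\<dots> = q_pochhammer x (x\<^sup>2) (Suc k) * q_pochhammer (x\<^sup>2) (x\<^sup>2) (Suc k)"
    unfolding Suc[symmetric]
    by (simp add: q_pochhammer_Suc power_mult_distrib power_mult power2_eq_square mult_ac)
  finally show ?case by simp
qed simp

lemma q_pochhammer_neq_0:
  fixes a y :: "'a::idom"
  assumes "\<And>i. i < k \<Longrightarrow> a * y ^ i \<noteq> 1"
  shows "q_pochhammer a y k \<noteq> 0"
  using assms by (force simp: q_pochhammer_def)

text \<open>One transfer principle for both evaluation at a complex point and the substitution of
  q^2 for x.\<close>

lemma q_pochhammer_hom:
  assumes "h 1 = 1" "\<And>a b. h (a * b) = h a * h b" "\<And>a b. h (a - b) = h a - h b"
  shows "h (q_pochhammer a y k) = q_pochhammer (h a) (h y) k"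
proof -
  have "h (y ^ i) = h y ^ i" for i
    by (induction i) (simp_all add: assms)
  then show ?thesis
    by (induction k) (simp_all add: assms q_pochhammer_Suc)
qed

text \<open>\<open>gauss_binom x m k\<close> is the Gaussian binomial coefficient usually written with \<open>m + k\<close> over \<open>k\<close>.\<close>

fun gauss_binom :: "'a::comm_ring_1 \<Rightarrow> nat \<Rightarrow> nat \<Rightarrow> 'a" where
  "gauss_binom x m 0 = 1"
| "gauss_binom x 0 (Suc k) = 1"
| "gauss_binom x (Suc m) (Suc k) =
     gauss_binom x (Suc m) k + x ^ Suc k * gauss_binom x m (Suc k)"

text \<open>Links the Pascal-type recursion with the product formula. Being free of division, it
  holds in every commutative ring, in particular for polynomials.\<close>

lemma gauss_binom_mult_q_pochhammer:
  "gauss_binom x m k * q_pochhammer x x k = q_pochhammer (x ^ Suc m) x k"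
proof (induction x m k rule: gauss_binom.induct)
  case (3 x m k)
  let ?F = "q_pochhammer (x ^ Suc (Suc m)) x k"
  have "gauss_binom x (Suc m) (Suc k) * q_pochhammer x x (Suc k) =
      gauss_binom x (Suc m) k * q_pochhammer x x k * (1 - x * x ^ k) +
      x ^ Suc k * (gauss_binom x m (Suc k) * q_pochhammer x x (Suc k))"
    by (simp add: q_pochhammer_Suc[of x x k] algebra_simps)
  \<comment> \<open>The factorial supplied by the second induction hypothesis is split at its first
    factor, so that both terms share \<open>?F\<close>.\<close>
  also have "\<dots> = ?F * (1 - x * x ^ k) + x ^ Suc k * ((1 - x ^ Suc m) * ?F)"
    unfolding 3 by (simp add: q_pochhammer_rec mult_ac)
  also have "\<dots> = ?F * (1 - x ^ Suc (Suc m) * x ^ k)"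
    by (simp add: algebra_simps)
  finally show ?case by (simp only: q_pochhammer_Suc)
qed simp_all

text \<open>Computing (x; x)_2k by parity and by halves gives (x; x^2)_k (x^2; x^2)_k = (x; x)_k
  (x^(k+1); x)_k; then (x^2; x^2)_k = (x; x)_k (-x; x)_k is inserted and (x; x)_k cancelled. This
  turns the odd-even quotient into a polynomial over a product of factors 1 + x^i.\<close>

lemma gauss_binom_diagonal:
  fixes x :: "'a::idom"
  assumes "q_pochhammer x x k \<noteq> 0"
  shows "gauss_binom x k k * q_pochhammer (x\<^sup>2) (x\<^sup>2) k =
    (q_pochhammer (- x) x k)\<^sup>2 * q_pochhammer x (x\<^sup>2) k"
proof -
  let ?P = "q_pochhammer x x k" and ?N = "q_pochhammer (- x) x k"
    and ?E = "q_pochhammer (x\<^sup>2) (x\<^sup>2) k" and ?O = "q_pochhammer x (x\<^sup>2) k"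
    and ?S = "q_pochhammer (x ^ Suc k) x k"
  have 1: "?O * ?E = ?P * ?S"
    using q_pochhammer_add[of x x k k] by (simp add: q_pochhammer_odd_even mult_2)
  have 2: "?P * ?N = ?E" by (rule q_pochhammer_mult_minus)
  have 3: "gauss_binom x k k * ?P = ?S" by (rule gauss_binom_mult_q_pochhammer)
  have "?P * (gauss_binom x k k * ?E) = (?P * ?S) * ?N"
    by (simp only: 2[symmetric] 3[symmetric] mult_ac)
  also have "\<dots> = ?P * (?N\<^sup>2 * ?O)"
    unfolding 1[symmetric] 2[symmetric] by (simp add: power2_eq_square mult_ac)
  finally show ?thesis using assms by simp
qed

text \<open>After multiplication by (x; x)_k both sides are (x^(m+1); x)_(k+1), split at its last or
  at its first factor. For m = k = n - 1 this exposes the factor 1 - x^n.\<close>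

lemma gauss_binom_shift:
  fixes x :: "'a::idom"
  assumes "q_pochhammer x x k \<noteq> 0"
  shows "gauss_binom x m k * (1 - x ^ (Suc m + k)) = (1 - x ^ Suc m) * gauss_binom x (Suc m) k"
proof -
  let ?P = "q_pochhammer x x k"
  have "?P * (gauss_binom x m k * (1 - x ^ (Suc m + k))) = q_pochhammer (x ^ Suc m) x (Suc k)"
    by (simp only: q_pochhammer_Suc gauss_binom_mult_q_pochhammer[symmetric] power_add mult_ac)
  also have "\<dots> = (1 - x ^ Suc m) * q_pochhammer (x ^ Suc (Suc m)) x k"
    by (simp add: q_pochhammer_rec mult_ac)
  also have "\<dots> = ?P * ((1 - x ^ Suc m) * gauss_binom x (Suc m) k)"
    by (simp only: gauss_binom_mult_q_pochhammer[symmetric] mult_ac)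
  finally show ?thesis using assms by simp
qed

section \<open>Telescoping of the truncated sum\<close>

lemma sum_q_pochhammer_closed_form:
  fixes z :: "'a::field"
  assumes z0: "z \<noteq> 0" and z1: "\<And>i. i > 0 \<Longrightarrow> z ^ i \<noteq> 1"
  shows "(\<Sum>k = 0..m. q_int z (4 * int k - 1)
      * ((q_pochhammer (z powi (-2)) (z ^ 4) k)\<^sup>2 / (q_pochhammer (z ^ 4) (z ^ 4) k)\<^sup>2)
      * z ^ (4 * k)) =
    - (1 + z ^ (4 * m + 1)) / (z * (1 + z))
      * (q_pochhammer (z\<^sup>2) (z ^ 4) m / q_pochhammer (z ^ 4) (z ^ 4) m)\<^sup>2"
proof -
  have nz: "1 - z \<noteq> 0" "1 + z \<noteq> 0"
  proof -
    show "1 - z \<noteq> 0" using z1[of 1] by simp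
    have "(1 - z) * (1 + z) = 1 - z\<^sup>2" by (simp add: algebra_simps power2_eq_square)
    then show "1 + z \<noteq> 0" using z1[of 2] by auto
  qed
  show ?thesis
  proof (induction m)
    case 0
    \<comment> \<open>The summand at k = 0 is [-1] = -1/z, which is also the closed form at m =
      0.\<close>
    have "q_int z (- 1) * z = - 1"
      using z0 nz by (simp add: q_int_def power_int_minus field_simps)
    then have "q_int z (- 1) * (z * (1 + z)) = - 1 - z"
      by (simp flip: mult.assoc)
    then show ?case using z0 nz by (simp add: divide_simps)
  next
    case (Suc m)
    define w where "w = z ^ (4 * m)"
    define P where "P = q_pochhammer (z\<^sup>2) (z ^ 4) m"
    define R where "R = q_pochhammer (z ^ 4) (z ^ 4) m"
    have R: "R \<noteq> 0" unfolding R_def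
      using z1 by (intro q_pochhammer_neq_0) (simp flip: power_mult power_add)
    have w: "(z ^ 4) ^ m = w" by (simp add: w_def power_mult)
    have u: "1 - z ^ 4 * w \<noteq> 0" using z1[of "4 + 4 * m"] by (simp add: w_def power_add)
    have P': "q_pochhammer (z\<^sup>2) (z ^ 4) (Suc m) = P * (1 - z\<^sup>2 * w)"
      and R': "q_pochhammer (z ^ 4) (z ^ 4) (Suc m) = R * (1 - z ^ 4 * w)"
      by (simp_all add: P_def R_def q_pochhammer_Suc w)
    \<comment> \<open>Shifting z^(-2) by one step z^4 gives z^2, so the next summand contains the
      same \<open>P\<close> as the closed form at m.\<close>
    have "z powi (-2) * z ^ 4 = z\<^sup>2"
      using z0 by (simp add: power_int_minus field_simps eval_nat_numeral)
    then have N': "q_pochhammer (z powi (-2)) (z ^ 4) (Suc m) = (1 - z powi (-2)) * P"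
      by (simp add: q_pochhammer_rec P_def)
    have i: "q_int z (4 * int (Suc m) - 1) = (1 - z ^ 3 * w) / (1 - z)"
    proof -
      have "4 * int (Suc m) - 1 = int (3 + 4 * m)" by simp
      then show ?thesis by (simp only: q_int_def power_int_of_nat power_add w_def)
    qed
    \<comment> \<open>A factor z^4 of z^(4(m+1)) clears the negative exponents; what remains of that
      power is \<open>w\<close>.\<close>
    have e: "(1 - z powi (-2))\<^sup>2 * z ^ 4 = (1 - z\<^sup>2)\<^sup>2"
    proof -
      have "(1 - z powi (-2)) * z\<^sup>2 = z\<^sup>2 - 1"
        using z0 by (simp add: power_int_minus field_simps)
      then have "((1 - z powi (-2)) * z\<^sup>2)\<^sup>2 = (1 - z\<^sup>2)\<^sup>2" by (simp add: power2_commute)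
      then show ?thesis by (simp add: power_mult_distrib flip: power_mult)
    qed
    have "q_int z (4 * int (Suc m) - 1)
      * ((q_pochhammer (z powi (-2)) (z ^ 4) (Suc m))\<^sup>2 / (q_pochhammer (z ^ 4) (z ^ 4) (Suc m))\<^sup>2)
      * z ^ (4 * Suc m) =
      (1 - z ^ 3 * w) / (1 - z) * (((1 - z powi (-2))\<^sup>2 * z ^ 4) * P\<^sup>2 / (R * (1 - z ^ 4 * w))\<^sup>2) * w"
      unfolding i N' R' by (simp add: power_add power_mult_distrib w_def)
    also have "\<dots> = (1 - z ^ 3 * w) * (1 - z) * (1 + z)\<^sup>2 * w * P\<^sup>2 / (R * (1 - z ^ 4 * w))\<^sup>2"
    proof -
      have "(1 - z\<^sup>2)\<^sup>2 = (1 - z) * ((1 - z) * (1 + z)\<^sup>2)" by algebra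
      then show ?thesis unfolding e using nz by simp
    qed
    \<comment> \<open>The telescoping itself: closed form at m + 1 minus closed form at m. Over a
      common denominator it is a polynomial identity in z, w and P.\<close>
    also have "\<dots> = - (1 + z ^ 5 * w) / (z * (1 + z)) * (P * (1 - z\<^sup>2 * w) / (R * (1 - z ^ 4 * w)))\<^sup>2
        - (- (1 + z * w) / (z * (1 + z)) * (P / R)\<^sup>2)"
    proof -
      have "(P / R)\<^sup>2 = (P * (1 - z ^ 4 * w) / (R * (1 - z ^ 4 * w)))\<^sup>2" using u by simp
      moreover have "(1 - z ^ 3 * w) * (1 - z) * (1 + z)\<^sup>2 * w * P\<^sup>2 * (z * (1 + z)) =
        - (1 + z ^ 5 * w) * (P * (1 - z\<^sup>2 * w))\<^sup>2 + (1 + z * w) * (P * (1 - z ^ 4 * w))\<^sup>2"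
        by algebra
      then have "(1 - z ^ 3 * w) * (1 - z) * (1 + z)\<^sup>2 * w * P\<^sup>2 =
        - (1 + z ^ 5 * w) / (z * (1 + z)) * (P * (1 - z\<^sup>2 * w))\<^sup>2
         - (- (1 + z * w) / (z * (1 + z)) * (P * (1 - z ^ 4 * w))\<^sup>2)"
        using z0 nz by (simp add: divide_simps) (simp add: algebra_simps)
      ultimately show ?thesis by (simp only: power_divide diff_divide_distrib times_divide_eq_right)
    qed
    finally show ?case
      unfolding sum.atLeast0_atMost_Suc Suc P' R' P_def[symmetric] R_def[symmetric]
      by (simp add: w_def power_add mult_ac)
  qed
qed


section \<open>Shifted factorials at roots of unity\<close>

text \<open>An odd exponent e is reflected to the even exponent 2k + 1 - e by 1 - \<zeta>^e =
  -\<zeta>^e (1 - \<zeta>^(2k+1-e)). The odd exponents 1, 3, ..., 2k-1 sum to k^2.\<close>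

lemma q_pochhammer_root_of_unity_reflect:
  fixes \<zeta> :: "'a::comm_ring_1"
  assumes root: "\<zeta> ^ (2 * k + 1) = 1"
  shows "q_pochhammer \<zeta> (\<zeta>\<^sup>2) k = (- 1) ^ k * \<zeta> ^ k\<^sup>2 * q_pochhammer (\<zeta>\<^sup>2) (\<zeta>\<^sup>2) k"
proof -
  \<comment> \<open>The product is reversed so that the factor with index i meets its partner, the
    factor with exponent 2i + 2.\<close>
  have "q_pochhammer \<zeta> (\<zeta>\<^sup>2) k = (\<Prod>i<k. 1 - \<zeta> * (\<zeta>\<^sup>2) ^ (k - Suc i))"
    unfolding q_pochhammer_def by (rule prod.nat_diff_reindex[symmetric])
  also have "\<dots> = (\<Prod>i<k. - (\<zeta> * (\<zeta>\<^sup>2) ^ (k - Suc i)) * (1 - \<zeta>\<^sup>2 * (\<zeta>\<^sup>2) ^ i))"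
  proof (intro prod.cong refl)
    fix i assume "i \<in> {..<k}"
    then have "\<zeta> * (\<zeta>\<^sup>2) ^ (k - Suc i) * (\<zeta>\<^sup>2 * (\<zeta>\<^sup>2) ^ i) = \<zeta> ^ (2 * k + 1)"
      by (simp only: power_mult[symmetric] power_add[symmetric] power_Suc[symmetric])
         (intro arg_cong[of _ _ "(^) \<zeta>"], simp)
    then show "1 - \<zeta> * (\<zeta>\<^sup>2) ^ (k - Suc i) =
        - (\<zeta> * (\<zeta>\<^sup>2) ^ (k - Suc i)) * (1 - \<zeta>\<^sup>2 * (\<zeta>\<^sup>2) ^ i)"
      using root by (simp add: algebra_simps)
  qed
  also have "\<dots> = (\<Prod>i<k. - (\<zeta> * (\<zeta>\<^sup>2) ^ (k - Suc i))) * q_pochhammer (\<zeta>\<^sup>2) (\<zeta>\<^sup>2) k"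
    by (simp only: prod.distrib q_pochhammer_def)
  also have "(\<Prod>i<k. - (\<zeta> * (\<zeta>\<^sup>2) ^ (k - Suc i))) = (\<Prod>i<k. - (\<zeta> * (\<zeta>\<^sup>2) ^ i))"
    by (rule prod.nat_diff_reindex)
  also have "\<dots> = (- 1) ^ k * \<zeta> ^ k\<^sup>2"
  proof (induction k)
    case (Suc k)
    have "(Suc k)\<^sup>2 = k\<^sup>2 + (1 + 2 * k)" by (simp add: power2_eq_square)
    then show ?case using Suc by (simp add: power_add mult_ac flip: power_mult)
  qed simp
  finally show ?thesis .
qed

text \<open>Doubling permutes the nonzero residues modulo 2k + 1.\<close>

lemma q_pochhammer_root_of_unity_odd_even:
  fixes \<zeta> :: "'a::comm_ring_1"
  assumes root: "\<zeta> ^ (2 * k + 1) = 1"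
  shows "q_pochhammer \<zeta> \<zeta> (2 * k) = q_pochhammer (\<zeta>\<^sup>2) (\<zeta>\<^sup>2) (2 * k)"
proof -
  \<comment> \<open>The second half of the doubled exponents starts at 2k + 2, which reduces to 1,
    so it runs through the odd exponents.\<close>
  have "\<zeta>\<^sup>2 * (\<zeta>\<^sup>2) ^ k = \<zeta> ^ (2 * k + 1) * \<zeta>"
    by (simp add: power2_eq_square power_add power_mult mult_2 mult_ac)
       (simp add: power_mult_distrib mult_2_right power_add power2_eq_square power_mult)
  then have "q_pochhammer (\<zeta>\<^sup>2) (\<zeta>\<^sup>2) (2 * k) =
      q_pochhammer (\<zeta>\<^sup>2) (\<zeta>\<^sup>2) k * q_pochhammer \<zeta> (\<zeta>\<^sup>2) k"
    using root q_pochhammer_add[of "\<zeta>\<^sup>2" "\<zeta>\<^sup>2" k k] by (simp add: mult_2)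
  then show ?thesis
    using q_pochhammer_odd_even[of \<zeta> k] by (simp add: mult_ac)
qed


section \<open>Divisibility by cyclotomic polynomials\<close>

definition eval_at :: "complex \<Rightarrow> rat poly \<Rightarrow> complex" where
  "eval_at \<zeta> p = poly (map_poly of_rat p) \<zeta>"

lemma eval_at_simps [simp]:
  "eval_at \<zeta> 1 = 1" "eval_at \<zeta> (p + r) = eval_at \<zeta> p + eval_at \<zeta> r"
  "eval_at \<zeta> (p - r) = eval_at \<zeta> p - eval_at \<zeta> r" "eval_at \<zeta> (p * r) = eval_at \<zeta> p * eval_at \<zeta> r"
  "eval_at \<zeta> (monom 1 i) = \<zeta> ^ i"
  by (simp_all add: eval_at_def map_poly_of_rat_add map_poly_of_rat_diff map_poly_of_rat_mult
      map_poly_monom poly_monom)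

lemma eval_at_power [simp]: "eval_at \<zeta> (p ^ i) = eval_at \<zeta> p ^ i"
  by (induction i) simp_all

lemma eval_at_uminus [simp]: "eval_at \<zeta> (- p) = - eval_at \<zeta> p"
  using eval_at_simps(3)[of \<zeta> 0 p] by (simp add: eval_at_def)

lemma eval_at_q_pochhammer:
  "eval_at \<zeta> (q_pochhammer a y k) = q_pochhammer (eval_at \<zeta> a) (eval_at \<zeta> y) k"
  by (rule q_pochhammer_hom) simp_all

lemma q_int_poly_mult: "(1 - monom 1 1) * q_int_poly m = 1 - monom 1 m"
  by (simp add: q_int_poly_def monom_altdef one_diff_power_eq)

definition primitive_root :: "nat \<Rightarrow> complex \<Rightarrow> bool" where
  "primitive_root n \<zeta> \<longleftrightarrow> (\<forall>i. \<zeta> ^ i = 1 \<longleftrightarrow> n dvd i)"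

lemma cis_primitive_root:
  assumes "n > 0" "coprime k n"
  shows "primitive_root n (cis (2 * pi * real k / real n))"
proof -
  let ?z = "cis (2 * pi * real k / real n)"
  have z: "?z ^ i = cis (2 * pi * (real (k * i) / real n))" for i
    unfolding DeMoivre by (simp add: mult_ac)
  have "n dvd i" if "?z ^ i = 1" for i
  proof -
    \<comment> \<open>The real part alone already forces the angle to be a multiple of 2 pi.\<close>
    have "cos (2 * pi * (real (k * i) / real n)) = 1"
      using that unfolding z by (metis cis.sel(1) one_complex.sel(1))
    then obtain m :: int where "2 * pi * (real (k * i) / real n) = of_int m * 2 * pi"
      by (subst (asm) cos_one_2pi_int) blast
    then have "real_of_int (int (k * i)) = real_of_int (m * int n)"
      using assms(1) by (simp add: field_simps)
    then have "int (k * i) = m * int n" by (simp only: of_int_eq_iff)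
    then have "n dvd k * i" by (metis dvd_triv_right int_dvd_int_iff)
    then show ?thesis using assms(2) by (simp add: coprime_commute coprime_dvd_mult_right_iff)
  qed
  moreover have "?z ^ i = 1" if "n dvd i" for i
  proof -
    from that obtain j where "i = n * j" ..
    then have "real (k * i) / real n = of_int (int (k * j))" using assms(1) by simp
    then show ?thesis unfolding z by (simp only: complex_eq_iff) simp
  qed
  ultimately show ?thesis unfolding primitive_root_def by blast
qed

text \<open>The remainder of \<open>f\<close> has degree below the number of totatives of n, yet
  vanishes at that many distinct primitive roots, so it is 0. This reduces congruences modulo the
  cyclotomic polynomial to evaluations.\<close>

lemma cyclotomic_dvd:
  assumes n: "n > 1" and "\<And>\<zeta>. primitive_root n \<zeta> \<Longrightarrow> eval_at \<zeta> f = 0"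
  shows "cyclotomic n dvd f"
proof -
  let ?h = "map_poly (of_rat :: rat \<Rightarrow> complex)"
  let ?z = "\<lambda>k. cis (2 * pi * real k / real n)"
  let ?Z = "?z ` totatives n"
  define r where "r = f mod cyclotomic n"
  have root: "primitive_root n \<zeta>" "eval_at \<zeta> (cyclotomic n) = 0" if "\<zeta> \<in> ?Z" for \<zeta>
    using that n cis_primitive_root[of n]
    by (auto simp: eval_at_def of_rat_cyclotomic cyclotomic_complex_def poly_prod in_totatives_iff)
  have "inj_on ?z {..<n}"
    using bij_betw_roots_unity[of n] n by (simp add: bij_betw_def)
  moreover have "totatives n \<subseteq> {..<n}"
    using n totatives_less by blast
  ultimately have card: "card ?Z = card (totatives n)"
    by (intro card_image) (rule inj_on_subset)
  have deg: "degree (cyclotomic n) = card (totatives n)"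
  proof -
    have "degree (cyclotomic_complex n) = card (totatives n)"
      unfolding cyclotomic_complex_def by (subst degree_prod_eq_sum_degree) auto
    then show ?thesis by (simp flip: of_rat_cyclotomic add: degree_map_poly_of_rat)
  qed
  have "eval_at \<zeta> r = 0" if "\<zeta> \<in> ?Z" for \<zeta>
  proof -
    have "f = f div cyclotomic n * cyclotomic n + r" by (simp add: r_def)
    then have "eval_at \<zeta> f = eval_at \<zeta> (f div cyclotomic n * cyclotomic n + r)" by simp
    then show ?thesis using assms(2)[OF root(1)[OF that]] root(2)[OF that] by simp
  qed
  then have Z: "?Z \<subseteq> {\<zeta>. poly (?h r) \<zeta> = 0}" by (auto simp: eval_at_def)
  have "r = 0"
  proof (rule ccontr)
    assume "r \<noteq> 0"
    then have "?h r \<noteq> 0" using map_poly_of_rat_eq_iff[of r 0] by simp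
    then have "card (totatives n) \<le> degree r"
      using card_mono[OF poly_roots_finite Z] card_poly_roots_bound[of "?h r"] card
      by (simp add: degree_map_poly_of_rat)
    moreover have "cyclotomic n \<noteq> 0"
      using cyclotomic_complex_neq_0[of n] by (auto simp flip: of_rat_cyclotomic)
    then have "degree r < degree (cyclotomic n)"
      using \<open>r \<noteq> 0\<close> degree_mod_less[of "cyclotomic n" f] by (simp add: r_def)
    ultimately show False using deg by simp
  qed
  then show ?thesis by (simp add: r_def mod_eq_0_iff_dvd)
qed

lemma eval_at_q_int_poly: "(1 - \<zeta>) * eval_at \<zeta> (q_int_poly m) = 1 - \<zeta> ^ m"
  using arg_cong[OF q_int_poly_mult[of m], of "eval_at \<zeta>"] by simp

lemma primitive_rootD:
  assumes "primitive_root n \<zeta>" "n > 1"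
  shows "\<zeta> \<noteq> 1" "\<zeta> ^ n = 1" "eval_at \<zeta> (q_int_poly n) = 0"
    "\<And>i. 0 < i \<Longrightarrow> i < n \<Longrightarrow> \<zeta> ^ i \<noteq> 1"
proof -
  show 1: "\<zeta> ^ i \<noteq> 1" if "0 < i" "i < n" for i
    using assms that unfolding primitive_root_def by (auto dest: dvd_imp_le)
  show 2: "\<zeta> ^ n = 1" using assms unfolding primitive_root_def by simp
  show "\<zeta> \<noteq> 1" using 1[of 1] assms by simp
  then show "eval_at \<zeta> (q_int_poly n) = 0" using eval_at_q_int_poly[of \<zeta> n] 2 by simp
qed

lemma cyclotomic_dvd_q_int_poly: "n > 1 \<Longrightarrow> cyclotomic n dvd q_int_poly n"
  by (intro cyclotomic_dvd primitive_rootD)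

text \<open>It has a complex root. Consequently a polynomial coprime to it cannot be 0.\<close>

lemma not_is_unit_q_int_poly:
  assumes "n > 1"
  shows "\<not> is_unit (q_int_poly n)"
proof
  let ?z = "cis (2 * pi * real 1 / real n)"
  assume "is_unit (q_int_poly n)"
  then obtain p where "1 = q_int_poly n * p" by (elim dvdE)
  then have "eval_at ?z 1 = eval_at ?z (q_int_poly n * p)" by simp
  then show False
    using primitive_rootD(3)[OF cis_primitive_root[of n 1]] assms by simp
qed

section \<open>Coprimality with \<open>q_int_poly n\<close>\<close>

lemma dvd_pcompose: "p dvd r \<Longrightarrow> p \<circ>\<^sub>p s dvd r \<circ>\<^sub>p s" for p r s :: "'a::comm_ring_1 poly"
  by (auto simp: pcompose_mult elim!: dvdE)

text \<open>A Bezout identity survives substitution.\<close>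

lemma coprime_pcompose:
  fixes p r s :: "'a::field_gcd poly"
  assumes "coprime p r"
  shows "coprime (p \<circ>\<^sub>p s) (r \<circ>\<^sub>p s)"
proof -
  obtain a b where "a * p + b * r = 1"
    using assms bezout_coefficients_fst_snd[of p r] by (metis coprime_imp_gcd_eq_1)
  then have "(a \<circ>\<^sub>p s) * (p \<circ>\<^sub>p s) + (b \<circ>\<^sub>p s) * (r \<circ>\<^sub>p s) = 1"
    by (simp flip: pcompose_mult pcompose_add add: pcompose_1)
  then show ?thesis
    by (intro coprimeI) (metis dvd_add dvd_mult)
qed

lemma coprime_linear:
  fixes p :: "'a::field_gcd poly"
  assumes "poly p a \<noteq> 0"
  shows "coprime [:- a, 1:] p"
proof (rule prime_elem_imp_coprime)
  show "prime_elem [:- a, 1:]" by (rule prime_elem_linear_field_poly) simp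
  show "\<not> [:- a, 1:] dvd p" using assms by (simp add: poly_eq_0_iff_dvd)
qed

lemma q_int_poly_add: "q_int_poly (i + j) = q_int_poly i + monom 1 i * q_int_poly j"
  by (induction j) (simp_all add: q_int_poly_def mult_monom distrib_left add.assoc)

text \<open>With m a = n b + 1, a common divisor divides both [m a] = 1 + x [n b] and [n b], hence
  1.\<close>

lemma coprime_q_int_poly:
  assumes "coprime m n" "n > 1"
  shows "coprime (q_int_poly m) (q_int_poly n)"
proof (rule coprimeI)
  let ?X = "monom (1::rat) 1"
  have mult: "q_int_poly i dvd q_int_poly (i * j)" for i j
    by (induction j) (simp_all add: q_int_poly_add dvd_add dvd_mult q_int_poly_def[of 0])
  show "is_unit c" if c: "c dvd q_int_poly m" "c dvd q_int_poly n" for c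
  proof -
    \<comment> \<open>The case m = 0 is impossible: coprimality would force n = 1.\<close>
    obtain a b where ab: "m * a = n * b + 1"
      using bezout_nat[of m n] assms by (cases "m = 0") auto
    have "c dvd q_int_poly (n * b + 1)"
      using dvd_trans[OF c(1) mult, of a] unfolding ab .
    moreover have "q_int_poly (n * b + 1) = 1 + ?X * q_int_poly (n * b)"
      using q_int_poly_add[of 1 "n * b"] by (simp add: q_int_poly_def add.commute)
    moreover have "c dvd ?X * q_int_poly (n * b)"
      using dvd_trans[OF c(2) mult] by simp
    ultimately show ?thesis by (simp add: dvd_add_left_iff)
  qed
qed

text \<open>A common divisor divides 1 - x^(n i), and for odd n also 1 + x^(n i); the sum 2 is a
  unit over the rationals.\<close>

lemma coprime_one_plus_monom:
  assumes "odd n"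
  shows "coprime (1 + monom 1 i :: rat poly) (q_int_poly n)"
proof (rule coprimeI)
  let ?Y = "monom (1::rat) i" and ?Z = "monom (1::rat) n"
  fix c assume c: "c dvd 1 + ?Y" "c dvd q_int_poly n"
  have dvd: "1 - y dvd 1 - y ^ m" for y :: "rat poly" and m
    by (simp add: one_diff_power_eq)
  have "q_int_poly n dvd 1 - ?Z" by (metis dvd_triv_right q_int_poly_mult)
  then have "c dvd 1 - ?Z" using c(2) by (rule dvd_trans[rotated])
  then have "c dvd 1 - ?Z ^ i" by (rule dvd_trans) (rule dvd)
  moreover have "c dvd 1 + ?Y ^ n"
    using dvd_trans[OF c(1)] dvd[of "- ?Y" n] assms by simp
  ultimately have "c dvd (1 - ?Z ^ i) + (1 + ?Y ^ n)" by (rule dvd_add)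
  then have "c dvd 2" by (simp add: monom_power mult.commute)
  moreover have "1 = (2 :: rat poly) * [:1 / 2:]" by (simp add: numeral_poly one_pCons)
  then have "is_unit (2 :: rat poly)" by (rule dvdI)
  ultimately show "is_unit c" by (rule dvd_trans)
qed



section \<open>Reduction to primitive roots of unity\<close>

lemma one_minus_monom_neq_0: "m > 0 \<Longrightarrow> 1 - monom (1::rat) m \<noteq> 0"
proof
  assume "m > 0" "1 - monom (1::rat) m = 0"
  then have "poly (1 - monom (1::rat) m) 0 = 0" by simp
  with \<open>m > 0\<close> show False by (simp add: poly_monom zero_power)
qed

lemma q_int_poly_dvd_one_minus_monom:
  "q_int_poly n \<circ>\<^sub>p monom 1 2 dvd 1 - monom 1 (2 * n)"
proof -
  have "q_int_poly n dvd 1 - monom 1 n" by (metis dvd_triv_right q_int_poly_mult)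
  then have "q_int_poly n \<circ>\<^sub>p monom 1 2 dvd (1 - monom 1 n) \<circ>\<^sub>p monom 1 2" by (rule dvd_pcompose)
  then show ?thesis by (simp add: pcompose_diff pcompose_1 pcompose_monom_monom)
qed

text \<open>The substitution of q^2 for x, followed by the embedding into rational functions:
  Gaussian binomials are handled in x, while the sum lives in q.\<close>

definition to_fract_q2 :: "rat poly \<Rightarrow> rat poly fract" where
  "to_fract_q2 p = to_fract (p \<circ>\<^sub>p monom 1 2)"

lemma to_fract_q2_simps [simp]:
  "to_fract_q2 1 = 1" "to_fract_q2 (p * r) = to_fract_q2 p * to_fract_q2 r"
  "to_fract_q2 (p - r) = to_fract_q2 p - to_fract_q2 r" "to_fract_q2 (monom 1 i) = q ^ (2 * i)"
  by (simp_all add: to_fract_q2_def pcompose_1 pcompose_mult pcompose_diff pcompose_monom_monom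
      to_fract_monom)

lemma to_fract_q2_q_pochhammer:
  "to_fract_q2 (q_pochhammer (monom 1 i) (monom 1 j) k) = q_pochhammer (q ^ (2 * i)) (q ^ (2 * j)) k"
  by (subst q_pochhammer_hom[where h = to_fract_q2]) simp_all

text \<open>Here \<open>b\<close> and \<open>d\<close> are polynomials in x = q^2, and
  \<open>R\<close> is one in q. By \<open>ratio\<close>, the quotient squared in the closed form is
  [n] b / d; by \<open>root\<close>, (b / d)^2 is x^j modulo the cyclotomic polynomial; the
  assumption on \<open>R\<close> replaces the prefactor (1 + q^(4m+1)) / (q (1 + q)) times x^j by
  \<open>R\<close>.\<close>

lemma truncated_sum_cong:
  fixes b d R :: "rat poly"
  assumes n: "n > 1"
    and cop: "coprime d (q_int_poly n)"
    and ratio: "q_pochhammer (monom 1 1) (monom 1 2) m * d =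
      q_int_poly n * b * q_pochhammer (monom 1 2) (monom 1 2) m"
    and root: "\<And>\<zeta>. primitive_root n \<zeta> \<Longrightarrow> (eval_at \<zeta> b)\<^sup>2 = \<zeta> ^ j * (eval_at \<zeta> d)\<^sup>2"
    and R: "q_int_poly n \<circ>\<^sub>p monom 1 2 dvd
      (1 + monom 1 1) * monom 1 1 * R - (1 + monom 1 (4 * m + 1)) * monom 1 (2 * j)"
  shows "rat_fun_cong
       (\<Sum>k = 0..m.
          q_int q (4 * int k - 1)
            * ((q_pochhammer (q powi (-2)) (q ^ 4) k)\<^sup>2 / (q_pochhammer (q ^ 4) (q ^ 4) k)\<^sup>2)
            * q ^ (4 * k))
       (- to_fract R * (q_int (q\<^sup>2) (int n))\<^sup>2)
       ((q_int_poly n \<circ>\<^sub>p monom 1 2)\<^sup>2 * (cyclotomic n \<circ>\<^sub>p monom 1 2))"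
proof -
  let ?Y = "monom (1::rat) 2" and ?q = "monom (1::rat) 1" and ?w = "monom (1::rat) (4 * m + 1)"
  define I where "I = q_int_poly n \<circ>\<^sub>p ?Y"
  define C where "C = cyclotomic n \<circ>\<^sub>p ?Y"
  define B where "B = b \<circ>\<^sub>p ?Y"
  define D where "D = d \<circ>\<^sub>p ?Y"
  have CI: "C dvd I"
    unfolding C_def I_def by (intro dvd_pcompose cyclotomic_dvd_q_int_poly n)
  have DI: "coprime D I" unfolding D_def I_def by (intro coprime_pcompose cop)
  have "d \<noteq> 0" using cop not_is_unit_q_int_poly[OF n] by auto
  then have D0: "D \<noteq> 0" unfolding D_def by (simp add: pcompose_eq_0_iff degree_monom_eq)
  have q: "?q = [:- 0, 1:]" "1 + ?q = [:- (- 1), 1:]"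
    by (simp_all add: monom_altdef one_pCons)
  \<comment> \<open>\<open>I\<close> takes the value 1 at 0 and n at -1, so neither point is a
    root.\<close>
  have "coprime ?q I" unfolding q(1)
    by (rule coprime_linear)
       (use n in \<open>simp add: I_def poly_pcompose poly_monom q_int_poly_def poly_sum power_0_left sum.If_cases\<close>)
  moreover have "coprime (1 + ?q) I" unfolding q(2)
    by (rule coprime_linear)
       (use n in \<open>simp add: I_def poly_pcompose poly_monom q_int_poly_def poly_sum\<close>)
  ultimately have "coprime (?q * (1 + ?q) * D\<^sup>2) I"
    using DI by (simp only: power2_eq_square coprime_mult_left_iff)
  \<comment> \<open>The modulus divides I^3, so coprimality to \<open>I\<close> is enough.\<close>
  then have "coprime (?q * (1 + ?q) * D\<^sup>2) (I\<^sup>2 * I)"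
    by (simp only: power2_eq_square coprime_mult_right_iff)
  then have cop': "coprime (?q * (1 + ?q) * D\<^sup>2) (I\<^sup>2 * C)"
    by (rule coprime_divisors[OF dvd_refl mult_dvd_mono[OF dvd_refl CI]])
  have "cyclotomic n dvd b\<^sup>2 - monom 1 j * d\<^sup>2"
    using root by (intro cyclotomic_dvd n) simp
  then have "C dvd (b\<^sup>2 - monom 1 j * d\<^sup>2) \<circ>\<^sub>p ?Y" unfolding C_def by (rule dvd_pcompose)
  then have C1: "C dvd B\<^sup>2 - monom 1 (2 * j) * D\<^sup>2"
    by (simp add: B_def D_def pcompose_diff pcompose_mult power2_eq_square pcompose_monom_monom)
  have C2: "C dvd (1 + ?q) * ?q * R - (1 + ?w) * monom 1 (2 * j)"
    using CI R unfolding I_def by (rule dvd_trans)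
  \<comment> \<open>The combination is chosen so that the mixed terms with q^(2j) D^2
    cancel.\<close>
  have "C dvd ((1 + ?q) * ?q * R - (1 + ?w) * monom 1 (2 * j)) * D\<^sup>2
      - (1 + ?w) * (B\<^sup>2 - monom 1 (2 * j) * D\<^sup>2)"
    by (rule dvd_diff[OF dvd_mult2[OF C2] dvd_mult[OF C1]])
  also have "\<dots> = (1 + ?q) * ?q * R * D\<^sup>2 - (1 + ?w) * B\<^sup>2"
    by (simp add: algebra_simps)
  finally have num: "I\<^sup>2 * C dvd I\<^sup>2 * ((1 + ?q) * ?q * R * D\<^sup>2 - (1 + ?w) * B\<^sup>2)" by simp
  have q1: "q ^ i \<noteq> 1" if "i > 0" for i using that by (rule q_power_neq_1)
  have q0: "q \<noteq> 0" "1 + q \<noteq> 0"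
    using q by (simp_all add: q_def flip: to_fract_1 to_fract_add)
  have nz: "?q * (1 + ?q) * D\<^sup>2 \<noteq> 0"
  proof -
    have "?q \<noteq> 0" unfolding q(1) by simp
    moreover have "1 + ?q \<noteq> 0" unfolding q(2) by simp
    ultimately show ?thesis using D0 by (intro no_zero_divisors power_not_zero)
  qed
  let ?A = "q_pochhammer (q\<^sup>2) (q ^ 4) m / q_pochhammer (q ^ 4) (q ^ 4) m"
  have E0: "q_pochhammer (q ^ 4) (q ^ 4) m \<noteq> 0"
    using q1 by (intro q_pochhammer_neq_0) (simp flip: power_mult power_add)
  have "q_pochhammer (q\<^sup>2) (q ^ 4) m * to_fract D =
      to_fract I * to_fract B * q_pochhammer (q ^ 4) (q ^ 4) m"
    using arg_cong[OF ratio, of to_fract_q2]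
    by (simp add: to_fract_q2_q_pochhammer) (simp add: to_fract_q2_def D_def B_def I_def)
  then have A: "?A = to_fract I * to_fract B / to_fract D"
    using E0 D0 by (simp add: field_simps)
  have I: "to_fract I = q_int (q\<^sup>2) (int n)"
    unfolding I_def by (rule to_fract_q_int_poly) simp
  let ?S = "\<Sum>k = 0..m.
          q_int q (4 * int k - 1)
            * ((q_pochhammer (q powi (-2)) (q ^ 4) k)\<^sup>2 / (q_pochhammer (q ^ 4) (q ^ 4) k)\<^sup>2)
            * q ^ (4 * k)"
  have S: "?S = - (1 + q ^ (4 * m + 1)) / (q * (1 + q)) * ?A\<^sup>2"
    by (rule sum_q_pochhammer_closed_form[OF q0(1)]) (rule q1)
  have "?S - (- to_fract R * (q_int (q\<^sup>2) (int n))\<^sup>2) =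
      - (1 + q ^ (4 * m + 1)) / (q * (1 + q)) * (to_fract I * to_fract B / to_fract D)\<^sup>2
        + to_fract R * (to_fract I)\<^sup>2"
    unfolding S A I by simp
  also have "\<dots> = (to_fract I)\<^sup>2 * ((1 + q) * q * to_fract R * (to_fract D)\<^sup>2
      - (1 + q ^ (4 * m + 1)) * (to_fract B)\<^sup>2) / (q * (1 + q) * (to_fract D)\<^sup>2)"
    using q0 D0 by (simp add: divide_simps power_mult_distrib) (simp add: algebra_simps)
  also have "\<dots> = Fract (I\<^sup>2 * ((1 + ?q) * ?q * R * D\<^sup>2 - (1 + ?w) * B\<^sup>2)) (?q * (1 + ?q) * D\<^sup>2)"
    by (simp add: Fract_conv_to_fract to_fract_power to_fract_monom)
  finally show ?thesis
    unfolding rat_fun_cong_def I_def[symmetric] C_def[symmetric] using num cop' nz by blast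
qed


section \<open>The two truncation points\<close>

lemma one_minus_monom_power: "1 - monom 1 i * monom 1 j = (1 - monom 1 1) * q_int_poly (i + j)"
  by (simp only: q_int_poly_mult mult_monom mult_1)

lemma coprime_q_pochhammer_minus:
  assumes "odd n"
  shows "coprime (q_pochhammer (- monom 1 1) (monom (1::rat) 1) k) (q_int_poly n)"
  unfolding q_pochhammer_def
  using coprime_one_plus_monom[OF assms]
  by (intro prod_coprime_left) (simp add: monom_power mult_monom)

text \<open>The exponents i, 2i, ..., k i all lie strictly between 0 and n.\<close>

lemma q_pochhammer_primitive_root_neq_0:
  assumes "primitive_root n \<zeta>" "n > 1" "0 < i" "i * k < n"
  shows "q_pochhammer (\<zeta> ^ i) (\<zeta> ^ i) k \<noteq> 0"
proof (rule q_pochhammer_neq_0)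
  fix j assume "j < k"
  then have "i * Suc j \<le> i * k" by (intro mult_le_mono2) simp
  with assms have "0 < i * Suc j" "i * Suc j < n" by simp_all
  then have "\<zeta> ^ (i * Suc j) \<noteq> 1" by (rule primitive_rootD(4)[OF assms(1,2)])
  then show "\<zeta> ^ i * (\<zeta> ^ i) ^ j \<noteq> 1" unfolding power_mult power_Suc .
qed

lemma q_pochhammer_monom_neq_0: "q_pochhammer (monom 1 1) (monom (1::rat) 1) k \<noteq> 0"
  using one_minus_monom_neq_0
  by (intro q_pochhammer_neq_0) (simp add: monom_power mult_monom)

lemma monom_square: "(monom (1::rat) 1)\<^sup>2 = monom 1 2"
  by (simp add: monom_power)

text \<open>At m = k + 1 the last factors of numerator and denominator contribute [n] / [n+1]; the
  diagonal Gaussian binomial covers the first k factors. Reflection at a root of unity yields the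
  exponent j = k + 1.\<close>

lemma truncated_sum_cong_half:
  assumes "k > 0" and n: "n = 2 * k + 1"
  shows "rat_fun_cong
       (\<Sum>k = 0..Suc k.
          q_int q (4 * int k - 1)
            * ((q_pochhammer (q powi (-2)) (q ^ 4) k)\<^sup>2 / (q_pochhammer (q ^ 4) (q ^ 4) k)\<^sup>2)
            * q ^ (4 * k))
       (- to_fract (monom 1 n * (1 - monom 1 1 + monom 1 2)) * (q_int (q\<^sup>2) (int n))\<^sup>2)
       ((q_int_poly n \<circ>\<^sub>p monom 1 2)\<^sup>2 * (cyclotomic n \<circ>\<^sub>p monom 1 2))"
proof (rule truncated_sum_cong)
  let ?X = "monom (1::rat) 1"
  let ?N = "q_pochhammer (- ?X) ?X k"
  let ?O = "q_pochhammer ?X (monom 1 2) k" and ?E = "q_pochhammer (monom 1 2) (monom (1::rat) 2) k"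
  let ?b = "gauss_binom ?X k k" and ?d = "q_int_poly (n + 1) * ?N\<^sup>2"
  show n1: "n > 1" using assms by simp
  have "coprime (q_int_poly (n + 1)) (q_int_poly n)"
    using n1 by (intro coprime_q_int_poly) simp_all
  moreover have "coprime ?N (q_int_poly n)" using n by (intro coprime_q_pochhammer_minus) simp
  ultimately show "coprime ?d (q_int_poly n)"
    by (simp only: power2_eq_square coprime_mult_left_iff)
  have diag: "?b * ?E = ?N\<^sup>2 * ?O"
    using gauss_binom_diagonal[OF q_pochhammer_monom_neq_0, of k] by (simp only: monom_square)
  have "q_pochhammer ?X (monom 1 2) (Suc k) = ?O * ((1 - ?X) * q_int_poly n)"
    by (simp add: q_pochhammer_Suc monom_power one_minus_monom_power n)
  moreover have "q_pochhammer (monom 1 2) (monom (1::rat) 2) (Suc k) =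
      ?E * ((1 - ?X) * q_int_poly (n + 1))"
    by (simp add: q_pochhammer_Suc monom_power one_minus_monom_power n)
  ultimately show "q_pochhammer ?X (monom 1 2) (Suc k) * ?d =
      q_int_poly n * ?b * q_pochhammer (monom 1 2) (monom 1 2) (Suc k)"
    using diag by algebra
  show "(eval_at \<zeta> ?b)\<^sup>2 = \<zeta> ^ Suc k * (eval_at \<zeta> ?d)\<^sup>2" if z: "primitive_root n \<zeta>" for \<zeta>
  proof -
    note z' = primitive_rootD[OF z n1]
    have E: "q_pochhammer (\<zeta>\<^sup>2) (\<zeta>\<^sup>2) k \<noteq> 0"
      using q_pochhammer_primitive_root_neq_0[OF z n1, of 2 k] n by simp
    have "(1 - \<zeta>) * eval_at \<zeta> (q_int_poly (n + 1)) = (1 - \<zeta>) * 1"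
      using eval_at_q_int_poly[of \<zeta> "n + 1"] z'(2) by simp
    then have 1: "eval_at \<zeta> (q_int_poly (n + 1)) = 1" using z'(1) by (simp del: mult_1_right)
    have "eval_at \<zeta> ?b * q_pochhammer (\<zeta>\<^sup>2) (\<zeta>\<^sup>2) k =
        (eval_at \<zeta> ?N)\<^sup>2 * q_pochhammer \<zeta> (\<zeta>\<^sup>2) k"
      using arg_cong[OF diag, of "eval_at \<zeta>"] by (simp add: eval_at_q_pochhammer)
    also have "\<dots> = (eval_at \<zeta> ?N)\<^sup>2 * ((- 1) ^ k * \<zeta> ^ k\<^sup>2) * q_pochhammer (\<zeta>\<^sup>2) (\<zeta>\<^sup>2) k"
      using q_pochhammer_root_of_unity_reflect[of \<zeta> k] z'(2) n by (simp add: mult_ac)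
    finally have b: "eval_at \<zeta> ?b = (eval_at \<zeta> ?N)\<^sup>2 * ((- 1) ^ k * \<zeta> ^ k\<^sup>2)"
      using E by simp
    \<comment> \<open>Reduces the exponent 2 k^2 modulo n.\<close>
    have "k\<^sup>2 * 2 = n * (k - 1) + Suc k"
      using \<open>k > 0\<close> n by (cases k) (simp_all add: power2_eq_square algebra_simps)
    then have "(\<zeta> ^ k\<^sup>2)\<^sup>2 = \<zeta> ^ Suc k"
      using z'(2) by (simp add: power_mult[symmetric]) (simp add: power_add power_mult)
    then have "((- 1) ^ k * \<zeta> ^ k\<^sup>2)\<^sup>2 = \<zeta> ^ Suc k"
      by (simp add: power_mult_distrib flip: power_mult)
    then show ?thesis
      using 1 b by (simp add: power_mult_distrib mult_ac)
  qed
  \<comment> \<open>The factor 1 - q + q^2 arises from (1 + q)(1 - q + q^2) = 1 + q^3: the first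
    product is q^(n+1) + q^(n+4), the second q^(n+1) + q^(3n+4).\<close>
  have "(1 + ?X) * ?X * (monom 1 n * (1 - ?X + monom 1 2))
      - (1 + monom 1 (4 * Suc k + 1)) * monom 1 (2 * Suc k) =
      monom 1 (n + 4) * (1 - monom 1 (2 * n))"
    by (simp add: algebra_simps mult_monom n) (simp add: numeral_eq_Suc)
  then show "q_int_poly n \<circ>\<^sub>p monom 1 2 dvd
      (1 + ?X) * ?X * (monom 1 n * (1 - ?X + monom 1 2))
      - (1 + monom 1 (4 * Suc k + 1)) * monom 1 (2 * Suc k)"
    using q_int_poly_dvd_one_minus_monom[of n] by (simp only: dvd_mult)
qed

text \<open>At m = n - 1 the factor [n] sits inside the central Gaussian binomial;
  \<open>gauss_binom_shift\<close> extracts it at the cost of [2n-1] in the denominator.\<close>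

lemma truncated_sum_cong_full:
  assumes "k > 0" and n: "n = 2 * k + 1"
  shows "rat_fun_cong
       (\<Sum>k = 0..2 * k.
          q_int q (4 * int k - 1)
            * ((q_pochhammer (q powi (-2)) (q ^ 4) k)\<^sup>2 / (q_pochhammer (q ^ 4) (q ^ 4) k)\<^sup>2)
            * q ^ (4 * k))
       (- to_fract (1 - monom 1 1 + monom 1 2) * (q_int (q\<^sup>2) (int n))\<^sup>2)
       ((q_int_poly n \<circ>\<^sub>p monom 1 2)\<^sup>2 * (cyclotomic n \<circ>\<^sub>p monom 1 2))"
proof (rule truncated_sum_cong)
  let ?X = "monom (1::rat) 1" and ?m = "2 * k"
  let ?N = "q_pochhammer (- ?X) ?X ?m"
  let ?O = "q_pochhammer ?X (monom 1 2) ?m" and ?E = "q_pochhammer (monom 1 2) (monom (1::rat) 2) ?m"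
  let ?b = "gauss_binom ?X n ?m" and ?d = "q_int_poly (n + ?m) * ?N\<^sup>2"
  show n1: "n > 1" using assms by simp
  have "coprime (n + ?m) n"
  proof (rule coprimeI)
    fix c assume "c dvd n + ?m" and c: "c dvd n"
    then have "c dvd ?m" by (simp add: dvd_add_right_iff)
    with c show "is_unit c" unfolding n by (simp only: dvd_add_right_iff)
  qed
  then have "coprime (q_int_poly (n + ?m)) (q_int_poly n)"
    using n1 by (intro coprime_q_int_poly) simp_all
  moreover have "coprime ?N (q_int_poly n)" using n by (intro coprime_q_pochhammer_minus) simp
  ultimately show "coprime ?d (q_int_poly n)"
    by (simp only: power2_eq_square coprime_mult_left_iff)
  have diag: "gauss_binom ?X ?m ?m * ?E = ?N\<^sup>2 * ?O"
    using gauss_binom_diagonal[OF q_pochhammer_monom_neq_0, of ?m] by (simp only: monom_square)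
  have "gauss_binom ?X ?m ?m * (1 - monom 1 (n + ?m)) = (1 - monom 1 n) * ?b"
    using gauss_binom_shift[OF q_pochhammer_monom_neq_0, of ?m ?m]
    by (simp only: n monom_power power_one mult_1 Suc_eq_plus1)
  then have "(1 - ?X) * (gauss_binom ?X ?m ?m * q_int_poly (n + ?m)) =
      (1 - ?X) * (q_int_poly n * ?b)"
    using q_int_poly_mult[of n] q_int_poly_mult[of "n + ?m"] by algebra
  then have shift: "gauss_binom ?X ?m ?m * q_int_poly (n + ?m) = q_int_poly n * ?b"
    using one_minus_monom_neq_0[of 1] by (simp only: mult_cancel_left) simp
  show "?O * ?d = q_int_poly n * ?b * ?E"
    using diag shift by algebra
  show "(eval_at \<zeta> ?b)\<^sup>2 = \<zeta> ^ 2 * (eval_at \<zeta> ?d)\<^sup>2" if z: "primitive_root n \<zeta>" for \<zeta>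
  proof -
    note z' = primitive_rootD[OF z n1]
    have P: "q_pochhammer \<zeta> \<zeta> ?m \<noteq> 0"
      using q_pochhammer_primitive_root_neq_0[OF z n1, of 1 ?m] n by simp
    \<comment> \<open>As n + 2k = 2n - 1, one more factor \<zeta> completes the exponent to 2n. This
      produces j = 2 after squaring.\<close>
    have "(1 - \<zeta>) * (\<zeta> * eval_at \<zeta> (q_int_poly (n + ?m))) = \<zeta> * (1 - \<zeta> ^ (n + ?m))"
      using eval_at_q_int_poly[of \<zeta> "n + ?m"] by (simp only: mult_ac)
    also have "\<dots> = \<zeta> - \<zeta> ^ (n + n)" by (simp add: n algebra_simps)
    also have "\<dots> = (1 - \<zeta>) * - 1" using z'(2) by (simp add: power_add)
    finally have 1: "\<zeta> * eval_at \<zeta> (q_int_poly (n + ?m)) = - 1"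
      using z'(1) by (simp only: mult_cancel_left) simp
    \<comment> \<open>The product formula starts at \<zeta>^(n+1) = \<zeta>, so numerator and
      denominator coincide.\<close>
    have "eval_at \<zeta> ?b * q_pochhammer \<zeta> \<zeta> ?m = q_pochhammer \<zeta> \<zeta> ?m"
      using arg_cong[OF gauss_binom_mult_q_pochhammer[of ?X n ?m], of "eval_at \<zeta>"] z'(2)
      by (simp add: eval_at_q_pochhammer)
    then have b: "eval_at \<zeta> ?b = 1" using P by simp
    have "q_pochhammer \<zeta> \<zeta> ?m * eval_at \<zeta> ?N = q_pochhammer \<zeta> \<zeta> ?m"
      using q_pochhammer_mult_minus[of \<zeta> ?m]
        q_pochhammer_root_of_unity_odd_even[OF z'(2)[unfolded n]]
      by (simp only: eval_at_q_pochhammer eval_at_uminus eval_at_simps power_one_right)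
    then have N: "eval_at \<zeta> ?N = 1" using P by simp
    have "(\<zeta> * eval_at \<zeta> (q_int_poly (n + ?m)))\<^sup>2 = 1" unfolding 1 by simp
    then show ?thesis
      by (simp only: b N eval_at_simps eval_at_power power_mult_distrib power_one mult_1_right)
  qed
  \<comment> \<open>Here q + q^4 is compared with q^4 + q^(4n+1).\<close>
  have "(1 + ?X) * ?X * (1 - ?X + monom 1 2)
      - (1 + monom 1 (4 * ?m + 1)) * monom 1 (2 * 2) =
      ?X * (1 + monom 1 (2 * n)) * (1 - monom 1 (2 * n))"
    by (simp add: algebra_simps mult_monom n) (simp add: numeral_eq_Suc)
  then show "q_int_poly n \<circ>\<^sub>p monom 1 2 dvd
      (1 + ?X) * ?X * (1 - ?X + monom 1 2)
      - (1 + monom 1 (4 * ?m + 1)) * monom 1 (2 * 2)"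
    using q_int_poly_dvd_one_minus_monom[of n] by (simp only: dvd_mult)
qed

theorem theorem1p3:
  fixes n :: nat
  assumes "n > 1" and "odd n"
  shows
    "rat_fun_cong
       (\<Sum>k = 0..(n + 1) div 2.
          q_int q (4 * int k - 1)
            * ((q_pochhammer (q powi (-2)) (q ^ 4) k)\<^sup>2 / (q_pochhammer (q ^ 4) (q ^ 4) k)\<^sup>2)
            * q ^ (4 * k))
       (- (q ^ n) * (1 - q + q\<^sup>2) * (q_int (q\<^sup>2) (int n))\<^sup>2)
       ((q_int_poly n \<circ>\<^sub>p monom 1 2)\<^sup>2 * (cyclotomic n \<circ>\<^sub>p monom 1 2))
     \<and>
     rat_fun_cong
       (\<Sum>k = 0..n - 1.
          q_int q (4 * int k - 1)
            * ((q_pochhammer (q powi (-2)) (q ^ 4) k)\<^sup>2 / (q_pochhammer (q ^ 4) (q ^ 4) k)\<^sup>2)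
            * q ^ (4 * k))
       (- (1 - q + q\<^sup>2) * (q_int (q\<^sup>2) (int n))\<^sup>2)
       ((q_int_poly n \<circ>\<^sub>p monom 1 2)\<^sup>2 * (cyclotomic n \<circ>\<^sub>p monom 1 2))"
proof -
  from \<open>odd n\<close> obtain k where n: "n = 2 * k + 1" by (elim oddE)
  with \<open>n > 1\<close> have "k > 0" by simp
  have "(n + 1) div 2 = Suc k" "n - 1 = 2 * k" using n by simp_all
  moreover have
    "to_fract (monom 1 n * (1 - monom 1 1 + monom 1 2)) = q ^ n * (1 - q + q\<^sup>2)"
    "to_fract (1 - monom 1 1 + monom 1 2) = 1 - q + q\<^sup>2"
    by (simp_all add: to_fract_monom)
  ultimately show ?thesis
    using truncated_sum_cong_half[OF \<open>k > 0\<close> n] truncated_sum_cong_full[OF \<open>k > 0\<close> n]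
    by (simp only: mult_minus_left)
qed

end
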